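(* Let $\Phi=(A;\{E_i\}_{i=0}^d;A^*;\{E^*_i\}_{i=0}^d)$ be a sharp tridiagonal system on $V$ with eigenvalue sequence $\{\theta_i\}_{i=0}^d$, dual eigenvalue sequence $\{\theta^*_i\}_{i=0}^d$ and split sequence $\{\zeta_i\}_{i=0}^d$. Then (i), (ii) hold. (i) For each of the tridiagonal systems $\Phi$, $\Phi^*$, $\Phi^{\downarrow\Downarrow}$, $\Phi^{\downarrow\Downarrow*}$ the last term (index $d$) in the split sequence is equal to $\zeta_d$. (ii) For each of the tridiagonal systems $\Phi^{\downarrow}$, $\Phi^{\Downarrow}$, $\Phi^{\downarrow*}$, $\Phi^{\Downarrow*}$ the last term (index $d$) in the split sequence is equal to $$\sum_{i=0}^d\eta_{d-i}(\theta_0)\,\eta^*_{d-i}(\theta^*_0)\,\zeta_i.$$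
   Context: $\mathbb{K}$ is a field and $V$ is a $\mathbb{K}$-vector space of finite positive dimension; $\mathrm{End}(V)$ is the algebra of $\mathbb{K}$-linear maps $V\to V$, with identity $I$. "Diagonalizable" means $V$ is spanned by the eigenspaces. A tridiagonal pair on $V$ is an ordered pair $A,A^*\in\mathrm{End}(V)$ ($A^*$ is just a name, not an adjoint) such that: (i) each of $A,A^*$ is diagonalizable; (ii) there is an ordering $\{V_i\}_{i=0}^d$ of the eigenspaces of $A$ with $A^*V_i\subseteq V_{i-1}+V_i+V_{i+1}$ for $0\le i\le d$ (where $V_{-1}=V_{d+1}=0$); (iii) there is an ordering $\{V^*_i\}_{i=0}^\delta$ of the eigenspaces of $A^*$ with $AV^*_i\subseteq V^*_{i-1}+V^*_i+V^*_{i+1}$ for $0\le i\le\delta$ (where $V^*_{-1}=V^*_{\delta+1}=0$); (iv) no subspace $W$ with $0\ne W\ne V$ satisfies $AW\subseteq W$ and $A^*W\subseteq W$. Orderings as in (ii), (iii) are called standard. It is known that $d=\delta$ and that $V_i,V_{d-i},V^*_i,V^*_{d-i}$ all have the same dimension for $0\le i\le d$. A tridiagonal system on $V$ is a sequence $\Phi=(A;\{E_i\}_{i=0}^d;A^*;\{E^*_i\}_{i=0}^d)$ where $A,A^*$ is a tridiagonal pair on $V$ and $\{E_i\}$ (resp. $\{E^*_i\}$) are the primitive idempotents (projections onto the eigenspaces along the other eigenspaces) of $A$ (resp. $A^*$), ordered so that the eigenspaces $\{E_iV\}$ (resp. $\{E^*_iV\}$) are in a standard order. $\theta_i$ (resp.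 $\theta^*_i$) is the eigenvalue of $A$ (resp. $A^*$) on $E_iV$ (resp. $E^*_iV$); $\{\theta_i\}$ and $\{\theta_i^*\}$ are the eigenvalue sequence and dual eigenvalue sequence of $\Phi$. $\Phi$ is sharp if $\dim E_0V=1$ (equivalently $\dim E^*_0V=1$). For an indeterminate $\lambda$ and $0\le i\le d$: $\eta_i=(\lambda-\theta_d)(\lambda-\theta_{d-1})\cdots(\lambda-\theta_{d-i+1})$ and $\eta^*_i=(\lambda-\theta^*_d)(\lambda-\theta^*_{d-1})\cdots(\lambda-\theta^*_{d-i+1})$. Split sequence: let $U_i=(E^*_0V+\cdots+E^*_iV)\cap(E_iV+\cdots+E_dV)$ for $0\le i\le d$. It is known that $V=U_0+\cdots+U_d$ is a direct sum, $U_0=E_0^*V$, $(A-\theta_iI)U_i\subseteq U_{i+1}$ and $(A^*-\theta^*_iI)U_i\subseteq U_{i-1}$ ($U_{-1}=U_{d+1}=0$). If $\Phi$ is sharp, $\dim U_0=1$ and $U_0$ is invariant under $(A^*-\theta^*_1I)(A^*-\theta^*_2I)\cdots(A^*-\theta^*_iI)(A-\theta_{i-1}I)\cdots(A-\theta_1I)(A-\theta_0I)$; the corresponding eigenvalue is $\zeta_i$, and $\{\zeta_i\}_{i=0}^d$ is the split sequence of $\Phi$. Relatives of $\Phi$ (all are tridiagonal systems on $V$, sharp if $\Phi$ is): $\Phi^{\downarrow}=(A;\{E_i\};A^*;\{E^*_{d-i}\})$, $\Phi^{\Downarrow}=(A;\{E_{d-i}\};A^*;\{E^*_i\})$, $\Phi^{\downarrow\Downarrow}=(A;\{E_{d-i}\};A^*;\{E^*_{d-i}\})$,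 $\Phi^{*}=(A^*;\{E^*_i\};A;\{E_i\})$, $\Phi^{\downarrow*}=(A^*;\{E^*_{d-i}\};A;\{E_i\})$, $\Phi^{\Downarrow*}=(A^*;\{E^*_i\};A;\{E_{d-i}\})$, $\Phi^{\downarrow\Downarrow*}=(A^*;\{E^*_{d-i}\};A;\{E_{d-i}\})$, with all sequences indexed by $0\le i\le d$. The split sequence of a relative is obtained by applying the definition of split sequence to that tridiagonal system (with its own eigenvalue and dual eigenvalue sequences). *)

theory Defs
  imports Main "HOL-Library.Set_Algebras" "HOL-Computational_Algebra.Polynomial"
begin

text \<open>
  The vector space \<open>V\<close> is the whole type \<open>'v\<close>, with scalar multiplication \<open>s\<close> over the field
  \<open>'k\<close>. Sums of subspaces are the pointwise sums of sets provided by \<open>Set_Algebras\<close>; the empty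
  sum is the zero subspace, so boundary terms with indices outside \<open>0..d\<close> are simply left out.
  A sequence indexed by \<open>0..d\<close> is a function on \<open>nat\<close> whose values above \<open>d\<close> are ignored.
\<close>

definition eigenspace :: "('k::field \<Rightarrow> 'v::ab_group_add \<Rightarrow> 'v) \<Rightarrow> ('v \<Rightarrow> 'v) \<Rightarrow> 'k \<Rightarrow> 'v set"
  where "eigenspace s A t = {v. A v = s t v}"

definition is_eigenvalue :: "('k::field \<Rightarrow> 'v::ab_group_add \<Rightarrow> 'v) \<Rightarrow> ('v \<Rightarrow> 'v) \<Rightarrow> 'k \<Rightarrow> bool"
  where "is_eigenvalue s A t \<longleftrightarrow> (\<exists>v. v \<noteq> 0 \<and> A v = s t v)"

definition eigenspaces :: "('k::field \<Rightarrow> 'v::ab_group_add \<Rightarrow> 'v) \<Rightarrow> ('v \<Rightarrow> 'v) \<Rightarrow> 'v set set"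
  where "eigenspaces s A = {eigenspace s A t | t. is_eigenvalue s A t}"

definition diagonalizable :: "('k::field \<Rightarrow> 'v::ab_group_add \<Rightarrow> 'v) \<Rightarrow> ('v \<Rightarrow> 'v) \<Rightarrow> bool"
  where "diagonalizable s A \<longleftrightarrow> module.span s (\<Union>(eigenspaces s A)) = UNIV"

text \<open>\<open>standard_ordering s A B d W\<close>: the sequence \<open>W 0, \<dots>, W d\<close> lists every eigenspace of \<open>A\<close>
  exactly once, and \<open>B\<close> acts on it in a block-tridiagonal way.\<close>

definition standard_ordering ::
  "('k::field \<Rightarrow> 'v::ab_group_add \<Rightarrow> 'v) \<Rightarrow> ('v \<Rightarrow> 'v) \<Rightarrow> ('v \<Rightarrow> 'v) \<Rightarrow> nat \<Rightarrow> (nat \<Rightarrow> 'v set) \<Rightarrow> bool"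
  where "standard_ordering s A B d W \<longleftrightarrow>
    bij_betw W {..d} (eigenspaces s A) \<and>
    (\<forall>i\<le>d. B ` W i \<subseteq> (\<Sum>j\<in>{j. j \<le> d \<and> i \<le> j + 1 \<and> j \<le> i + 1}. W j))"

definition tridiagonal_pair ::
  "('k::field \<Rightarrow> 'v::ab_group_add \<Rightarrow> 'v) \<Rightarrow> ('v \<Rightarrow> 'v) \<Rightarrow> ('v \<Rightarrow> 'v) \<Rightarrow> bool"
  where "tridiagonal_pair s A A' \<longleftrightarrow>
    Vector_Spaces.linear s s A \<and> Vector_Spaces.linear s s A' \<and>
    diagonalizable s A \<and> diagonalizable s A' \<and>
    (\<exists>d W. standard_ordering s A A' d W) \<and>
    (\<exists>\<delta> W'. standard_ordering s A' A \<delta> W') \<and>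
    \<not> (\<exists>W. module.subspace s W \<and> W \<noteq> {0} \<and> W \<noteq> UNIV \<and> A ` W \<subseteq> W \<and> A' ` W \<subseteq> W)"

text \<open>For diagonalizable \<open>A\<close> and each eigenvalue \<open>t\<close>, exactly one linear \<open>F\<close> satisfies the two
  conditions below: the projection onto the eigenspace of \<open>t\<close> along the other eigenspaces.\<close>

definition primitive_idempotents ::
  "('k::field \<Rightarrow> 'v::ab_group_add \<Rightarrow> 'v) \<Rightarrow> ('v \<Rightarrow> 'v) \<Rightarrow> ('v \<Rightarrow> 'v) set"
  where "primitive_idempotents s A =
    {F. Vector_Spaces.linear s s F \<and>
        (\<exists>t. is_eigenvalue s A t \<and> (\<forall>v\<in>eigenspace s A t. F v = v) \<and>
             (\<forall>t'. t' \<noteq> t \<longrightarrow> (\<forall>v\<in>eigenspace s A t'. F v = 0)))}"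

definition tridiagonal_system ::
  "('k::field \<Rightarrow> 'v::ab_group_add \<Rightarrow> 'v) \<Rightarrow> nat \<Rightarrow>
   ('v \<Rightarrow> 'v) \<Rightarrow> (nat \<Rightarrow> 'v \<Rightarrow> 'v) \<Rightarrow> ('v \<Rightarrow> 'v) \<Rightarrow> (nat \<Rightarrow> 'v \<Rightarrow> 'v) \<Rightarrow> bool"
  where "tridiagonal_system s d A E A' E' \<longleftrightarrow>
    tridiagonal_pair s A A' \<and>
    bij_betw E {..d} (primitive_idempotents s A) \<and>
    bij_betw E' {..d} (primitive_idempotents s A') \<and>
    standard_ordering s A A' d (\<lambda>i. range (E i)) \<and>
    standard_ordering s A' A d (\<lambda>i. range (E' i))"

definition sharp :: "('k::field \<Rightarrow> 'v::ab_group_add \<Rightarrow> 'v) \<Rightarrow> (nat \<Rightarrow> 'v \<Rightarrow> 'v) \<Rightarrow> bool"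
  where "sharp s E \<longleftrightarrow> vector_space.dim s (range (E 0)) = 1"

definition eigenvalue_seq ::
  "('k::field \<Rightarrow> 'v::ab_group_add \<Rightarrow> 'v) \<Rightarrow> ('v \<Rightarrow> 'v) \<Rightarrow> (nat \<Rightarrow> 'v \<Rightarrow> 'v) \<Rightarrow> nat \<Rightarrow> 'k"
  where "eigenvalue_seq s A E i = (THE t. \<forall>v\<in>range (E i). A v = s t v)"

text \<open>\<open>eta_poly d \<theta> i\<close> is \<open>(\<lambda> - \<theta> d) (\<lambda> - \<theta> (d - 1)) \<cdots> (\<lambda> - \<theta> (d - i + 1))\<close>.\<close>

definition eta_poly :: "nat \<Rightarrow> (nat \<Rightarrow> 'k::field) \<Rightarrow> nat \<Rightarrow> 'k poly"
  where "eta_poly d \<theta> i = (\<Prod>j<i. [:- \<theta> (d - j), 1:])"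

definition split_space ::
  "nat \<Rightarrow> (nat \<Rightarrow> 'v::ab_group_add \<Rightarrow> 'v) \<Rightarrow> (nat \<Rightarrow> 'v \<Rightarrow> 'v) \<Rightarrow> nat \<Rightarrow> 'v set"
  where "split_space d E E' i = (\<Sum>j\<in>{0..i}. range (E' j)) \<inter> (\<Sum>j\<in>{i..d}. range (E j))"

definition shifted :: "('k::field \<Rightarrow> 'v::ab_group_add \<Rightarrow> 'v) \<Rightarrow> ('v \<Rightarrow> 'v) \<Rightarrow> 'k \<Rightarrow> 'v \<Rightarrow> 'v"
  where "shifted s A t v = A v - s t v"

text \<open>\<open>comp_list [f, g, \<dots>, h] = f \<circ> g \<circ> \<dots> \<circ> h\<close>\<close>

definition comp_list :: "('v \<Rightarrow> 'v) list \<Rightarrow> 'v \<Rightarrow> 'v"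
  where "comp_list fs = foldr (\<circ>) fs id"

text \<open>\<open>(A' - \<theta>' 1) \<cdots> (A' - \<theta>' i) (A - \<theta> (i - 1)) \<cdots> (A - \<theta> 0)\<close>\<close>

definition split_operator ::
  "('k::field \<Rightarrow> 'v::ab_group_add \<Rightarrow> 'v) \<Rightarrow>
   ('v \<Rightarrow> 'v) \<Rightarrow> (nat \<Rightarrow> 'v \<Rightarrow> 'v) \<Rightarrow> ('v \<Rightarrow> 'v) \<Rightarrow> (nat \<Rightarrow> 'v \<Rightarrow> 'v) \<Rightarrow> nat \<Rightarrow> 'v \<Rightarrow> 'v"
  where "split_operator s A E A' E' i =
    comp_list (map (\<lambda>j. shifted s A' (eigenvalue_seq s A' E' j)) [1..<Suc i]) \<circ>
    comp_list (map (\<lambda>j. shifted s A (eigenvalue_seq s A E j)) (rev [0..<i]))"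

definition split_seq ::
  "('k::field \<Rightarrow> 'v::ab_group_add \<Rightarrow> 'v) \<Rightarrow> nat \<Rightarrow>
   ('v \<Rightarrow> 'v) \<Rightarrow> (nat \<Rightarrow> 'v \<Rightarrow> 'v) \<Rightarrow> ('v \<Rightarrow> 'v) \<Rightarrow> (nat \<Rightarrow> 'v \<Rightarrow> 'v) \<Rightarrow> nat \<Rightarrow> 'k"
  where "split_seq s d A E A' E' i =
    (THE z. \<forall>u\<in>split_space d E E' 0. split_operator s A E A' E' i u = s z u)"

end

theory Submission
  imports Defs
begin

text \<open>
  All \<open>\<zeta> i\<close> are read off from \<open>E' 0\<close>: if \<open>a\<close> spans \<open>E' 0 V\<close> and \<open>\<tau> i\<close> is the product of the
  \<open>A - \<theta> j\<close> with \<open>j < i\<close>, then \<open>\<tau> i a\<close> lies in the sum of the \<open>E' j V\<close> with \<open>j \<le> i\<close>, so the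
  product of the \<open>A' - \<theta>' j\<close> with \<open>1 \<le> j \<le> i\<close> acts on it as a multiple of \<open>E' 0\<close>. In particular
  the last term is the trace of \<open>E d E' 0\<close> times the products of the differences
  \<open>\<theta> d - \<theta> j\<close> and \<open>\<theta>' 0 - \<theta>' j\<close>. As a trace is symmetric, each of the last terms in question
  agrees with that of one of \<open>\<Phi>\<close>, \<open>\<Phi>\<^sup>*\<close>, \<open>\<Phi>\<^sup>\<Down>\<close>, \<open>\<Phi>\<^sup>\<Down>\<^sup>*\<close>.

  Newton interpolation writes the product of the \<open>A - \<theta> j\<close> with \<open>1 \<le> j \<le> d\<close>, a multiple of
  \<open>E 0\<close>, as a combination of the \<open>\<tau> i\<close>. Compressing to \<open>E' 0 V\<close> yields the sum in (ii), while
  compressing from \<open>E' 0 V\<close> to \<open>E' d V\<close> leaves only the term \<open>\<tau> d\<close> and shows that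
  \<open>E' d E 0 E' 0\<close> and \<open>E' d E d E' 0\<close> are proportional. Combining two relatives of this relation
  gives equality of the last terms for \<open>\<Phi>\<close> and \<open>\<Phi>\<^sup>*\<close>, once \<open>E' 0 E 0 \<noteq> 0\<close> is known; that is
  where irreducibility is used.
\<close>

section \<open>Spectral components of one map and the tridiagonal action of the other\<close>

text \<open>This is one half of a tridiagonal system. Keeping the halves apart lets the same facts
  serve \<open>A\<close> and \<open>A'\<close>, and lets either ordering be reversed on its own.
  Condition (ii) takes the form that the blocks \<open>E i A' E j\<close> vanish off the three
  central diagonals.\<close>

locale tridiagonal_action = vector_space s
  for s :: "'k::field \<Rightarrow> 'v::ab_group_add \<Rightarrow> 'v" +
  fixes d :: nat and A :: "'v \<Rightarrow> 'v" and E :: "nat \<Rightarrow> 'v \<Rightarrow> 'v" and \<theta> :: "nat \<Rightarrow> 'k"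
    and A' :: "'v \<Rightarrow> 'v"
  assumes linear_op: "Vector_Spaces.linear s s A"
    and linear_proj: "i \<le> d \<Longrightarrow> Vector_Spaces.linear s s (E i)"
    and proj_sum: "(\<Sum>i\<le>d. E i v) = v"
    and proj_proj: "i \<le> d \<Longrightarrow> j \<le> d \<Longrightarrow> E i (E j v) = (if i = j then E j v else 0)"
    and op_proj: "i \<le> d \<Longrightarrow> A (E i v) = s (\<theta> i) (E i v)"
    and proj_nonzero: "i \<le> d \<Longrightarrow> \<exists>v. E i v \<noteq> 0"
    and linear_op': "Vector_Spaces.linear s s A'"
    and tridiagonal: "i \<le> d \<Longrightarrow> j \<le> d \<Longrightarrow> j + 1 < i \<or> i + 1 < j \<Longrightarrow> E i (A' (E j v)) = 0"
    and inj_eigenvalues: "inj_on \<theta> {..d}"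
begin

lemma proj_scale [simp]: "i \<le> d \<Longrightarrow> E i (s c v) = s c (E i v)"
  and proj_zero [simp]: "i \<le> d \<Longrightarrow> E i 0 = 0"
  and proj_diff: "i \<le> d \<Longrightarrow> E i (v - w) = E i v - E i w"
  and proj_of_sum: "i \<le> d \<Longrightarrow> E i (sum f I) = (\<Sum>x\<in>I. E i (f x))"
proof -
  assume "i \<le> d"
  then interpret F: Vector_Spaces.linear s s "E i" by (rule linear_proj)
  show "E i (s c v) = s c (E i v)" "E i 0 = 0" "E i (v - w) = E i v - E i w"
    "E i (sum f I) = (\<Sum>x\<in>I. E i (f x))"
    by (simp_all add: F.scale F.diff F.sum)
qed

lemma op_sum: "A (sum f I) = (\<Sum>x\<in>I. A (f x))"
proof -
  interpret F: Vector_Spaces.linear s s A by (rule linear_op)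
  show ?thesis by (rule F.sum)
qed

lemma proj_op: assumes "k \<le> d" shows "E k (A v) = s (\<theta> k) (E k v)"
proof -
  have "A v = (\<Sum>i\<le>d. s (\<theta> i) (E i v))"
    by (subst proj_sum[of v, symmetric], subst op_sum) (simp add: op_proj)
  then have "E k (A v) = (\<Sum>i\<le>d. s (\<theta> i) (E k (E i v)))"
    using assms by (simp add: proj_of_sum)
  also have "\<dots> = (\<Sum>i\<le>d. if k = i then s (\<theta> i) (E i v) else 0)"
    using assms by (intro sum.cong) (auto simp: proj_proj)
  finally show ?thesis using assms by simp
qed

lemma proj_eqI: assumes "\<And>k. k \<le> d \<Longrightarrow> E k v = E k w" shows "v = w"
proof -
  have "(\<Sum>i\<le>d. E i v) = (\<Sum>i\<le>d. E i w)" using assms by simp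
  then show ?thesis by (simp only: proj_sum)
qed

text \<open>Splitting \<open>v\<close> into its components, only those with index
  \<open>k - 1\<close>, \<open>k\<close>, \<open>k + 1\<close> can contribute to component
  \<open>k\<close> of \<open>A' v\<close>.\<close>

lemma proj_op'_eq_0:
  assumes "k \<le> d" and "\<And>j. j \<le> d \<Longrightarrow> E j v = 0 \<or> j + 1 < k \<or> k + 1 < j"
  shows "E k (A' v) = 0"
proof -
  interpret F: Vector_Spaces.linear s s A' by (rule linear_op')
  have "E k (A' v) = E k (A' (\<Sum>j\<le>d. E j v))" by (simp add: proj_sum)
  also have "\<dots> = (\<Sum>j\<le>d. E k (A' (E j v)))"
    using assms(1) by (simp add: F.sum proj_of_sum)
  also have "\<dots> = 0"
  proof (rule sum.neutral, rule ballI)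
    fix j assume "j \<in> {..d}"
    then have j: "j \<le> d" by simp
    show "E k (A' (E j v)) = 0"
      using assms(2)[OF j] tridiagonal[OF assms(1) j, of v] assms(1) F.zero by auto
  qed
  finally show ?thesis .
qed

lemma eigenvalue_seq_eq: assumes "i \<le> d" shows "eigenvalue_seq s A E i = \<theta> i"
  unfolding eigenvalue_seq_def
proof (rule the_equality)
  show "\<forall>v\<in>range (E i). A v = s (\<theta> i) v" using assms op_proj by auto
next
  fix t assume t: "\<forall>v\<in>range (E i). A v = s t v"
  obtain v where v: "E i v \<noteq> 0" using proj_nonzero assms by blast
  have "s t (E i v) = s (\<theta> i) (E i v)" using t op_proj[OF assms] by (metis rangeI)
  then show "t = \<theta> i" using v by simp
qed

lemma proj_shifted: "k \<le> d \<Longrightarrow> E k (shifted s A t v) = s (\<theta> k - t) (E k v)"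
  by (simp add: shifted_def proj_diff proj_op scale_left_diff_distrib)

lemma proj_comp_shifted:
  "k \<le> d \<Longrightarrow> E k (comp_list (map (\<lambda>j. shifted s A (t j)) js) v)
     = s (\<Prod>j\<leftarrow>js. \<theta> k - t j) (E k v)"
  by (induction js) (simp_all add: comp_list_def proj_shifted)

text \<open>Each factor \<open>A' - t j\<close> raises the highest index of a nonzero component by
  at most one, whatever the scalars are.\<close>

lemma low_comp_shifted:
  assumes "\<And>k. k \<le> d \<Longrightarrow> m < k \<Longrightarrow> E k v = 0" "k \<le> d" "m + length js < k"
  shows "E k (comp_list (map (\<lambda>j. shifted s A' (t j)) js) v) = 0"
  using assms(2,3)
proof (induction js arbitrary: k)
  case Nil
  then show ?case using assms(1) by (simp add: comp_list_def)
next
  case (Cons a js)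
  let ?w = "comp_list (map (\<lambda>j. shifted s A' (t j)) js) v"
  have w: "comp_list (map (\<lambda>j. shifted s A' (t j)) (a # js)) v = A' ?w - s (t a) ?w"
    by (simp add: comp_list_def shifted_def)
  have "E k ?w = 0" using Cons by simp
  moreover have "E k (A' ?w) = 0"
  proof (rule proj_op'_eq_0)
    show "k \<le> d" by fact
    fix j assume "j \<le> d"
    then show "E j ?w = 0 \<or> j + 1 < k \<or> k + 1 < j"
      using Cons by (cases "m + length js < j") auto
  qed
  ultimately show ?case unfolding w using Cons.prems by (simp add: proj_diff)
qed

lemma tridiagonal_action_reverse:
  "tridiagonal_action s d A (\<lambda>i. E (d - i)) (\<lambda>i. \<theta> (d - i)) A'"
proof (intro tridiagonal_action.intro tridiagonal_action_axioms.intro)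
  show "vector_space s" by unfold_locales
  show "Vector_Spaces.linear s s A" "Vector_Spaces.linear s s A'"
    by (fact linear_op linear_op')+
  show "(\<Sum>i\<le>d. E (d - i) v) = v" for v
    using proj_sum[of v] sum.nat_diff_reindex[of "\<lambda>i. E i v" "Suc d"]
    by (simp add: lessThan_Suc_atMost)
  show "inj_on (\<lambda>i. \<theta> (d - i)) {..d}"
  proof (rule inj_onI)
    fix i j assume "i \<in> {..d}" "j \<in> {..d}" "\<theta> (d - i) = \<theta> (d - j)"
    then have "d - i = d - j" using inj_onD[OF inj_eigenvalues, of "d - i" "d - j"] by simp
    then show "i = j" using \<open>i \<in> {..d}\<close> \<open>j \<in> {..d}\<close> by simp
  qed
  show "E (d - i) (E (d - j) v) = (if i = j then E (d - j) v else 0)" if "i \<le> d" "j \<le> d" for i j v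
    using that by (auto simp: proj_proj)
  show "E (d - i) (A' (E (d - j) v)) = 0" if "i \<le> d" "j \<le> d" "j + 1 < i \<or> i + 1 < j" for i j v
    using that by (intro tridiagonal) auto
qed (simp_all add: linear_proj op_proj proj_nonzero)

end

section \<open>From the definitions to the component description\<close>

lemma tridiagonal_actionI:
  fixes s :: "'k::field \<Rightarrow> 'v::ab_group_add \<Rightarrow> 'v"
  assumes "vector_space s" and A: "Vector_Spaces.linear s s A" and A': "Vector_Spaces.linear s s A'"
    and diag: "diagonalizable s A" and E: "E ` {..d} \<subseteq> primitive_idempotents s A"
    and ord: "standard_ordering s A A' d (\<lambda>i. range (E i))"
  shows "tridiagonal_action s d A E (eigenvalue_seq s A E) A'"
proof -
  interpret vector_space s by fact
  interpret A: Vector_Spaces.linear s s A by fact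
  have "\<forall>i\<in>{..d}. \<exists>t. Vector_Spaces.linear s s (E i) \<and> is_eigenvalue s A t \<and>
      (\<forall>v. A v = s t v \<longrightarrow> E i v = v) \<and>
      (\<forall>t'. t' \<noteq> t \<longrightarrow> (\<forall>v. A v = s t' v \<longrightarrow> E i v = 0))"
  proof
    fix i assume "i \<in> {..d}"
    then have "E i \<in> primitive_idempotents s A" using E by blast
    then show "\<exists>t. Vector_Spaces.linear s s (E i) \<and> is_eigenvalue s A t \<and>
      (\<forall>v. A v = s t v \<longrightarrow> E i v = v) \<and>
      (\<forall>t'. t' \<noteq> t \<longrightarrow> (\<forall>v. A v = s t' v \<longrightarrow> E i v = 0))"
      by (simp add: primitive_idempotents_def eigenspace_def)
  qed
  from bchoice[OF this] obtain t where t0: "\<forall>i\<in>{..d}. Vector_Spaces.linear s s (E i) \<and>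
      is_eigenvalue s A (t i) \<and> (\<forall>v. A v = s (t i) v \<longrightarrow> E i v = v) \<and>
      (\<forall>t'. t' \<noteq> t i \<longrightarrow> (\<forall>v. A v = s t' v \<longrightarrow> E i v = 0))"
    by (rule exE)
  then have t: "\<And>i. i \<le> d \<Longrightarrow> Vector_Spaces.linear s s (E i)"
    "\<And>i. i \<le> d \<Longrightarrow> is_eigenvalue s A (t i)"
    "\<And>i v. i \<le> d \<Longrightarrow> A v = s (t i) v \<Longrightarrow> E i v = v"
    "\<And>i t' v. i \<le> d \<Longrightarrow> t' \<noteq> t i \<Longrightarrow> A v = s t' v \<Longrightarrow> E i v = 0"
    by simp_all
  \<comment> \<open>Diagonalizability enters only through this principle: a linear condition need
    only be checked on eigenvectors, since these span.\<close>
  have induct: "P v"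
    if "subspace {v. P v}" "\<And>t v. is_eigenvalue s A t \<Longrightarrow> A v = s t v \<Longrightarrow> P v" for P v
  proof -
    have "v \<in> span (\<Union>(eigenspaces s A))" using diag by (simp add: diagonalizable_def)
    then show ?thesis
      by (rule span_induct) (use that in \<open>auto simp: eigenspaces_def eigenspace_def\<close>)
  qed
  have op: "A (E i v) = s (t i) (E i v)" if i: "i \<le> d" for i v
  proof -
    interpret F: Vector_Spaces.linear s s "E i" using t(1) i .
    show ?thesis
    proof (rule induct[where P = "\<lambda>v. A (E i v) = s (t i) (E i v)"])
      show "subspace {v. A (E i v) = s (t i) (E i v)}"
        by (auto simp: subspace_def F.add F.scale F.zero A.add A.scale A.zero
            scale_right_distrib mult.commute)
    next
      fix t' v assume "A v = s t' v"
      then show "A (E i v) = s (t i) (E i v)"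
        using t(3,4)[OF i] A.zero by (cases "t' = t i") auto
    qed
  qed
  have range: "range (E i) = eigenspace s A (t i)" if "i \<le> d" for i
    unfolding eigenspace_def using op[OF that] t(3)[OF that] by (auto intro: range_eqI[OF sym])
  have nz: "\<exists>v. E i v \<noteq> 0" if "i \<le> d" for i
    using t(2,3)[OF that] unfolding is_eigenvalue_def by metis
  have bij: "bij_betw (\<lambda>i. range (E i)) {..d} (eigenspaces s A)"
    using ord by (simp add: standard_ordering_def)
  have inj: "inj_on t {..d}"
  proof (rule inj_onI)
    fix i j assume "i \<in> {..d}" "j \<in> {..d}" "t i = t j"
    then show "i = j"
      using bij_betw_imp_inj_on[OF bij] range by (auto simp: inj_on_def)
  qed
  \<comment> \<open>The ordering lists eigenspaces, not eigenvalues; a nonzero vector common to two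
    descriptions of one eigenspace identifies the eigenvalue.\<close>
  have eigen: "\<exists>i\<le>d. t' = t i" if ev: "is_eigenvalue s A t'" for t'
  proof -
    have "eigenspace s A t' \<in> (\<lambda>i. range (E i)) ` {..d}"
      using bij_betw_imp_surj_on[OF bij] ev by (auto simp: eigenspaces_def)
    then obtain i where i: "i \<le> d" "eigenspace s A t' = eigenspace s A (t i)"
      using range by auto
    obtain v where "v \<noteq> 0" "A v = s t' v" using ev by (auto simp: is_eigenvalue_def)
    then have "v \<in> eigenspace s A (t i)"
      unfolding i(2)[symmetric] by (simp add: eigenspace_def)
    then have "s t' v = s (t i) v" using \<open>A v = s t' v\<close> by (simp add: eigenspace_def)
    then have "t' = t i" using \<open>v \<noteq> 0\<close> by simp
    then show ?thesis using i by auto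
  qed
  have orth: "E i (E j v) = (if i = j then E j v else 0)" if "i \<le> d" "j \<le> d" for i j v
    using t(3)[OF that(1) op[OF that(1)]] t(4)[OF that(1) _ op[OF that(2)]] inj that
    by (auto simp: inj_on_def)
  have "tridiagonal_action s d A E t A'"
  proof (intro tridiagonal_action.intro tridiagonal_action_axioms.intro)
    show "vector_space s" by fact
    show "Vector_Spaces.linear s s A" "Vector_Spaces.linear s s A'" by fact+
    show "i \<le> d \<Longrightarrow> Vector_Spaces.linear s s (E i)" for i by (rule t(1))
    show "i \<le> d \<Longrightarrow> A (E i v) = s (t i) (E i v)" for i v by (rule op)
    show "inj_on t {..d}" by (rule inj)
    show "i \<le> d \<Longrightarrow> \<exists>v. E i v \<noteq> 0" for i by (rule nz)
    show "i \<le> d \<Longrightarrow> j \<le> d \<Longrightarrow> E i (E j v) = (if i = j then E j v else 0)" for i j v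
      by (rule orth)
    show "(\<Sum>i\<le>d. E i v) = v" for v
    proof (rule induct[where P = "\<lambda>v. (\<Sum>i\<le>d. E i v) = v"])
      interpret P: vector_space_pair s s by unfold_locales
      interpret F: Vector_Spaces.linear s s "\<lambda>v. \<Sum>i\<le>d. E i v"
        by (rule P.linear_compose_sum) (use t(1) in auto)
      show "subspace {v. (\<Sum>i\<le>d. E i v) = v}"
        by (auto simp: subspace_def F.add F.scale F.zero)
    next
      fix t' v assume ev: "is_eigenvalue s A t'" and v: "A v = s t' v"
      obtain j where j: "j \<le> d" "t' = t j" using eigen[OF ev] by auto
      have "(\<Sum>i\<le>d. E i v) = (\<Sum>i\<le>d. if i = j then v else 0)"
      proof (rule sum.cong[OF refl])
        fix i assume "i \<in> {..d}"
        then show "E i v = (if i = j then v else 0)"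
          using t(3)[of j v] t(4)[of i t' v] inj j v by (auto simp: inj_on_def)
      qed
      then show "(\<Sum>i\<le>d. E i v) = v" using j by simp
    qed
    show "E i (A' (E j v)) = 0" if "i \<le> d" "j \<le> d" "j + 1 < i \<or> i + 1 < j" for i j v
    proof -
      interpret F: Vector_Spaces.linear s s "E i" using t(1) that(1) .
      let ?N = "{k. k \<le> d \<and> j \<le> k + 1 \<and> k \<le> j + 1}"
      have fin: "finite ?N" by (rule finite_subset[of _ "{..d}"]) auto
      have "A' (E j v) \<in> (\<Sum>k\<in>?N. range (E k))"
        using ord that(2) unfolding standard_ordering_def by blast
      then obtain w where w: "A' (E j v) = sum w ?N" "\<forall>k\<in>?N. w k \<in> range (E k)"
        unfolding set_sum_alt[OF fin] by blast
      have "E i (w k) = 0" if k: "k \<in> ?N" for k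
      proof -
        obtain u where "w k = E k u" using w k by auto
        moreover have "i \<noteq> k" using k \<open>j + 1 < i \<or> i + 1 < j\<close> by auto
        ultimately show ?thesis using orth[of i k u] \<open>i \<le> d\<close> k by simp
      qed
      then show ?thesis unfolding w(1) F.sum by (rule sum.neutral[OF ballI])
    qed
  qed
  then interpret T: tridiagonal_action s d A E t A' .
  \<comment> \<open>The chosen \<open>t\<close> and \<open>eigenvalue_seq s A E\<close> agree only
    up to index \<open>d\<close>, so the locale axioms are transferred one by one.\<close>
  show ?thesis
    using T.eigenvalue_seq_eq T.tridiagonal_action_axioms
    unfolding tridiagonal_action_def tridiagonal_action_axioms_def
    by (auto simp: inj_on_def)
qed

section \<open>Maps of rank one\<close>

text \<open>The map is written as a functional times a vector. If \<open>G\<close> is given likewise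
  by \<open>\<psi>\<close> and \<open>e\<close>, the trace of \<open>F \<circ> G\<close> is
  \<open>\<phi> e * \<psi> a\<close>; all traces below appear as such products.\<close>

definition rank_one ::
  "('k::field \<Rightarrow> 'v::ab_group_add \<Rightarrow> 'v) \<Rightarrow> ('v \<Rightarrow> 'v) \<Rightarrow> ('v \<Rightarrow> 'k) \<Rightarrow> 'v \<Rightarrow> bool"
  where "rank_one s F \<phi> a \<longleftrightarrow> a \<in> range F \<and> a \<noteq> 0 \<and> (\<forall>v. F v = s (\<phi> v) a)"

lemma (in vector_space) rank_one_if_dim_eq_1:
  assumes "dim (range F) = 1"
  shows "\<exists>\<phi> a. rank_one scale F \<phi> a"
proof -
  obtain B where B: "B \<subseteq> range F" "independent B" "range F \<subseteq> span B" "card B = dim (range F)"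
    using basis_exists by blast
  then obtain a where a: "B = {a}" using assms by (auto simp: card_1_singleton_iff)
  have "\<forall>v. \<exists>c. F v = scale c a" using B(3) unfolding a span_singleton by auto
  then obtain \<phi> where "\<forall>v. F v = scale (\<phi> v) a" by metis
  moreover have "a \<noteq> 0" using B(2) a dependent_zero by auto
  ultimately have "rank_one scale F \<phi> a" using B(1) a unfolding rank_one_def by blast
  then show ?thesis by blast
qed

lemma (in vector_space) rank_one_scale:
  assumes "rank_one scale F \<phi> a" "Vector_Spaces.linear scale scale F"
  shows "\<phi> (scale c v) = c * \<phi> v"
proof -
  interpret F: Vector_Spaces.linear scale scale F by fact
  have "scale (\<phi> (scale c v)) a = scale (c * \<phi> v) a"
    using assms(1) F.scale[of c v] by (simp add: rank_one_def)
  then show ?thesis using assms(1) by (simp add: rank_one_def)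
qed

section \<open>Eigenvalue differences and Newton interpolation\<close>

text \<open>The product of the \<open>A - \<theta> j\<close> with \<open>1 \<le> j \<le> d\<close>
  is this scalar times \<open>E 0\<close>; \<open>last_differences\<close> plays the same part for
  \<open>j < d\<close> and \<open>E d\<close>.\<close>

definition first_differences :: "nat \<Rightarrow> (nat \<Rightarrow> 'k::field) \<Rightarrow> 'k"
  where "first_differences d \<theta> = (\<Prod>j=1..d. \<theta> 0 - \<theta> j)"

definition last_differences :: "nat \<Rightarrow> (nat \<Rightarrow> 'k::field) \<Rightarrow> 'k"
  where "last_differences d \<theta> = (\<Prod>j<d. \<theta> d - \<theta> j)"

lemma first_differences_reverse [simp]:
  "first_differences d (\<lambda>i. \<theta> (d - i)) = last_differences d \<theta>"
  unfolding first_differences_def last_differences_def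
  by (rule prod.reindex_bij_witness[of _ "\<lambda>j. d - j" "\<lambda>j. d - j"]) auto

lemma last_differences_reverse [simp]:
  "last_differences d (\<lambda>i. \<theta> (d - i)) = first_differences d \<theta>"
  unfolding first_differences_def last_differences_def
  by (rule prod.reindex_bij_witness[of _ "\<lambda>j. d - j" "\<lambda>j. d - j"]) auto

lemma poly_eta_poly:
  assumes "i \<le> d"
  shows "poly (eta_poly d \<theta> (d - i)) x = (\<Prod>j\<in>{i<..d}. x - \<theta> j)"
  unfolding eta_poly_def poly_prod
  by (rule prod.reindex_bij_witness[of _ "\<lambda>j. d - j" "\<lambda>j. d - j"]) (use assms in auto)

text \<open>The partial sums telescope because \<open>(\<theta> 0 - \<theta> (m + 1)) + (x -
  \<theta> 0) = x - \<theta> (m + 1)\<close>. For \<open>m = d\<close> this is the Newton expansion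
  of the product of the \<open>x - \<theta> j\<close> with \<open>1 \<le> j \<le> d\<close>.\<close>

lemma newton_expansion:
  fixes \<theta> :: "nat \<Rightarrow> 'k::field"
  assumes "m \<le> d"
  shows "(\<Sum>i\<le>m. (\<Prod>j\<in>{i<..d}. \<theta> 0 - \<theta> j) * (\<Prod>j<i. x - \<theta> j)) =
    (\<Prod>j=1..m. x - \<theta> j) * (\<Prod>j\<in>{m<..d}. \<theta> 0 - \<theta> j)"
  using assms
proof (induction m)
  case 0
  then show ?case by simp
next
  case (Suc m)
  have "{m<..d} = insert (Suc m) {Suc m<..d}" using Suc.prems by auto
  then have 1: "(\<Prod>j\<in>{m<..d}. \<theta> 0 - \<theta> j) =
      (\<theta> 0 - \<theta> (Suc m)) * (\<Prod>j\<in>{Suc m<..d}. \<theta> 0 - \<theta> j)" by simp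
  have 2: "(\<Prod>j<Suc m. x - \<theta> j) = (x - \<theta> 0) * (\<Prod>j=1..m. x - \<theta> j)"
    by (simp add: prod.lessThan_Suc_shift prod.atLeast1_atMost_eq del: prod.lessThan_Suc)
  have 3: "(\<Prod>j=1..Suc m. x - \<theta> j) = (\<Prod>j=1..m. x - \<theta> j) * (x - \<theta> (Suc m))"
    by simp
  show ?case
    unfolding sum.atMost_Suc using Suc unfolding 2 3 by (simp add: 1 algebra_simps)
qed

section \<open>Tridiagonal systems and their relatives\<close>

locale tridiagonal_sys =
  vector_space s + L: tridiagonal_action s d A E \<theta> A' + R: tridiagonal_action s d A' E' \<theta>' A
  for s :: "'k::field \<Rightarrow> 'v::ab_group_add \<Rightarrow> 'v"
    and d :: nat and A :: "'v \<Rightarrow> 'v" and E :: "nat \<Rightarrow> 'v \<Rightarrow> 'v" and \<theta> :: "nat \<Rightarrow> 'k"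
    and A' :: "'v \<Rightarrow> 'v" and E' :: "nat \<Rightarrow> 'v \<Rightarrow> 'v" and \<theta>' :: "nat \<Rightarrow> 'k" +
  assumes irreducible: "subspace W \<Longrightarrow> A ` W \<subseteq> W \<Longrightarrow> A' ` W \<subseteq> W \<Longrightarrow> W = {0} \<or> W = UNIV"
begin

lemma dual: "tridiagonal_sys s d A' E' \<theta>' A E \<theta>"
  by (rule tridiagonal_sys.intro[OF vector_space_axioms R.tridiagonal_action_axioms
        L.tridiagonal_action_axioms tridiagonal_sys_axioms.intro[OF irreducible]])

lemma reverse: "tridiagonal_sys s d A (\<lambda>i. E (d - i)) (\<lambda>i. \<theta> (d - i)) A' E' \<theta>'"
  by (rule tridiagonal_sys.intro[OF vector_space_axioms L.tridiagonal_action_reverse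
        R.tridiagonal_action_axioms tridiagonal_sys_axioms.intro[OF irreducible]])

lemma reverse': "tridiagonal_sys s d A E \<theta> A' (\<lambda>i. E' (d - i)) (\<lambda>i. \<theta>' (d - i))"
  by (rule tridiagonal_sys.dual[OF tridiagonal_sys.reverse[OF dual]])

section \<open>Irreducibility and the transfer of sharpness\<close>

lemma E0_injective:
  assumes "\<And>k. k \<le> d \<Longrightarrow> 0 < k \<Longrightarrow> E' k v = 0" "E 0 v = 0"
  shows "v = 0"
proof -
  interpret A: Vector_Spaces.linear s s A by (rule L.linear_op)
  interpret A': Vector_Spaces.linear s s A' by (rule R.linear_op)
  interpret E0: Vector_Spaces.linear s s "E 0" by (rule L.linear_proj) simp
  \<comment> \<open>\<open>W i\<close> is the intersection of \<open>E' 0 V + \<dots> + E' i V\<close> and \<open>E (i + 1) V + \<dots> + E d V\<close>;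
    \<open>A - \<theta> (i + 1)\<close> maps it into \<open>W (i + 1)\<close> and \<open>A' - \<theta>' i\<close> maps it into \<open>W (i - 1)\<close>, so the
    span of all of them is an invariant subspace killed by \<open>E 0\<close>.\<close>
  define W where "W i = {v. (\<forall>k\<le>d. i < k \<longrightarrow> E' k v = 0) \<and> (\<forall>k\<le>i. E k v = 0)}" for i
  let ?S = "span (\<Union>i\<le>d. W i)"
  have W_S: "v \<in> ?S" if "i \<le> d" "v \<in> W i" for i v
    using that by (intro span_base) auto
  have A_W: "A v \<in> ?S" if i: "i \<le> d" and v: "v \<in> W i" for i v
  proof (cases "i = d")
    case True
    \<comment> \<open>For \<open>i = d\<close> every component \<open>E k v\<close> vanishes, so
      \<open>W d\<close> is zero and no \<open>\<theta> (d + 1)\<close> is called for.\<close>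
    have "v = 0" by (rule L.proj_eqI) (use v True in \<open>simp add: W_def\<close>)
    then show ?thesis by (simp add: A.zero span_zero)
  next
    case False
    then have "Suc i \<le> d" using i by simp
    have "A v - s (\<theta> (Suc i)) v \<in> W (Suc i)"
      unfolding W_def
    proof (intro CollectI conjI allI impI)
      fix k assume k: "k \<le> d" "Suc i < k"
      have "E' k (A v) = 0"
      proof (rule R.proj_op'_eq_0[OF k(1)])
        fix j assume "j \<le> d"
        then show "E' j v = 0 \<or> j + 1 < k \<or> k + 1 < j"
          using v k by (cases "i < j") (auto simp: W_def)
      qed
      then show "E' k (A v - s (\<theta> (Suc i)) v) = 0"
        using k v by (simp add: R.proj_diff W_def)
    next
      fix k assume "k \<le> Suc i"
      then show "E k (A v - s (\<theta> (Suc i)) v) = 0"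
        using v \<open>Suc i \<le> d\<close> by (cases "k = Suc i") (auto simp: L.proj_diff L.proj_op W_def)
    qed
    then have "A v - s (\<theta> (Suc i)) v \<in> ?S" using \<open>Suc i \<le> d\<close> W_S by blast
    then show ?thesis using W_S[OF i v] by (metis diff_add_cancel span_add span_scale)
  qed
  have A'_W: "A' v \<in> ?S" if i: "i \<le> d" and v: "v \<in> W i" for i v
  proof -
    have hi: "E' k (A' v - s (\<theta>' i) v) = 0" if "k \<le> d" "i \<le> k" for k
      using v that by (cases "k = i") (auto simp: R.proj_diff R.proj_op W_def)
    have "A' v - s (\<theta>' i) v \<in> ?S"
    proof (cases i)
      case 0
      \<comment> \<open>\<open>W 0\<close> lies in \<open>E' 0 V\<close>, where \<open>A'\<close>
        acts as \<open>\<theta>' 0\<close>; this replaces the missing \<open>W (-1)\<close>.\<close>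
      have "A' v - s (\<theta>' i) v = 0" by (rule R.proj_eqI) (use hi 0 in simp)
      then show ?thesis by (simp add: span_zero)
    next
      case (Suc i')
      have "A' v - s (\<theta>' i) v \<in> W i'"
        unfolding W_def
      proof (intro CollectI conjI allI impI)
        fix k assume "k \<le> d" "i' < k"
        then show "E' k (A' v - s (\<theta>' i) v) = 0" using hi Suc by simp
      next
        fix k assume k: "k \<le> i'"
        have "E k (A' v) = 0"
        proof (rule L.proj_op'_eq_0)
          show "k \<le> d" using k i Suc by simp
          fix j assume "j \<le> d"
          then show "E j v = 0 \<or> j + 1 < k \<or> k + 1 < j"
            using v k Suc by (cases "j \<le> i") (auto simp: W_def)
        qed
        then show "E k (A' v - s (\<theta>' i) v) = 0"
          using k v i Suc by (simp add: L.proj_diff W_def)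
      qed
      then show ?thesis using W_S[of i'] i Suc by simp
    qed
    then show ?thesis using W_S[OF i v] by (metis diff_add_cancel span_add span_scale)
  qed
  have "A x \<in> ?S" if "x \<in> ?S" for x
    using that
    by (rule span_induct) (use A_W in \<open>auto simp: subspace_def A.zero A.add A.scale
        span_zero span_add span_scale\<close>)
  moreover have "A' x \<in> ?S" if "x \<in> ?S" for x
    using that
    by (rule span_induct) (use A'_W in \<open>auto simp: subspace_def A'.zero A'.add A'.scale
        span_zero span_add span_scale\<close>)
  ultimately have "?S = {0} \<or> ?S = UNIV"
    by (intro irreducible subspace_span) auto
  moreover have "E 0 x = 0" if "x \<in> ?S" for x
    using that
    by (rule span_induct) (auto simp: W_def subspace_def E0.zero E0.add E0.scale)
  then have "?S \<noteq> UNIV" using L.proj_nonzero[of 0] by auto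
  \<comment> \<open>The hypotheses say that \<open>v\<close> is in \<open>W 0\<close>, and the span
    is proper, hence zero.\<close>
  moreover have "v \<in> ?S"
    using assms by (intro W_S[of 0]) (auto simp: W_def)
  ultimately show ?thesis by blast
qed

lemma E0_range_injective: assumes "v \<in> range (E' 0)" "E 0 v = 0" shows "v = 0"
  by (rule E0_injective) (use assms in \<open>auto simp: R.proj_proj\<close>)

text \<open>\<open>E 0\<close> embeds \<open>E' 0 V\<close> into the line \<open>E 0 V\<close>.
  Applied to relatives, this carries sharpness to \<open>E' d\<close> and \<open>E d\<close> as
  well.\<close>

lemma rank_one_E'0:
  assumes "rank_one s (E 0) \<phi> e"
  shows "\<exists>\<alpha> a. rank_one s (E' 0) \<alpha> a"
proof -
  obtain w where w: "E' 0 w \<noteq> 0" using R.proj_nonzero[of 0] by auto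
  let ?a = "E' 0 w"
  have E0: "E 0 v = s (\<phi> v) e" for v using assms by (simp add: rank_one_def)
  have nz: "\<phi> ?a \<noteq> 0" using E0_range_injective[of ?a] w E0[of ?a] by auto
  have "E' 0 v = s (\<phi> (E' 0 v) / \<phi> ?a) ?a" for v
  proof -
    \<comment> \<open>The multiple of \<open>?a\<close> is chosen to have the same image under
      \<open>E 0\<close> as \<open>E' 0 v\<close>.\<close>
    let ?u = "E' 0 v - s (\<phi> (E' 0 v) / \<phi> ?a) ?a"
    have "?u = E' 0 (v - s (\<phi> (E' 0 v) / \<phi> ?a) w)" by (simp add: R.proj_diff)
    moreover have "E 0 ?u = E 0 (E' 0 v) - s (\<phi> (E' 0 v) / \<phi> ?a) (E 0 ?a)"
      by (simp add: L.proj_diff)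
    then have "E 0 ?u = 0"
      unfolding E0[of "E' 0 v"] E0[of ?a] using nz by simp
    ultimately have "?u = 0" using E0_range_injective by (metis rangeI)
    then show ?thesis by simp
  qed
  then have "rank_one s (E' 0) (\<lambda>v. \<phi> (E' 0 v) / \<phi> ?a) ?a"
    using w unfolding rank_one_def by blast
  then show ?thesis by blast
qed

section \<open>The products \<open>\<tau> i\<close> and the corner relations\<close>

text \<open>The factors are listed in the order of \<open>split_operator\<close>, so
  \<open>\<tau> i\<close> is its right-hand part once the eigenvalues are named.\<close>

definition \<tau> :: "nat \<Rightarrow> 'v \<Rightarrow> 'v"
  where "\<tau> i = comp_list (map (\<lambda>j. shifted s A (\<theta> j)) (rev [0..<i]))"

lemma proj_\<tau>: "k \<le> d \<Longrightarrow> E k (\<tau> i v) = s (\<Prod>j<i. \<theta> k - \<theta> j) (E k v)"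
  unfolding \<tau>_def L.proj_comp_shifted
  by (simp add: atLeast0LessThan flip: prod.distinct_set_conv_list)

lemma \<tau>_scale: "\<tau> i (s c v) = s c (\<tau> i v)"
  by (rule L.proj_eqI) (simp add: proj_\<tau> mult.commute)

lemma \<tau>_d: "\<tau> d v = s (last_differences d \<theta>) (E d v)"
proof (rule L.proj_eqI)
  fix k assume k: "k \<le> d"
  have "(\<Prod>j<d. \<theta> k - \<theta> j) = 0" if "k \<noteq> d"
    using k that by (intro prod_zero) auto
  then show "E k (\<tau> d v) = E k (s (last_differences d \<theta>) (E d v))"
    using k by (cases "k = d") (auto simp: proj_\<tau> L.proj_proj last_differences_def)
qed

lemma low_\<tau>:
  assumes "v \<in> range (E' 0)" "i < k" "k \<le> d"
  shows "E' k (\<tau> i v) = 0"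
  unfolding \<tau>_def
  by (rule R.low_comp_shifted[of 0]) (use assms in \<open>auto simp: R.proj_proj\<close>)

text \<open>On the component \<open>E k v\<close> both sides are scalars, and Newton expansion at
  \<open>x = \<theta> k\<close> compares them; the product obtained vanishes unless
  \<open>k = 0\<close>.\<close>

lemma first_differences_E0:
  "s (first_differences d \<theta>) (E 0 v) = (\<Sum>i\<le>d. s (\<Prod>j\<in>{i<..d}. \<theta> 0 - \<theta> j) (\<tau> i v))"
proof (rule L.proj_eqI)
  fix k assume k: "k \<le> d"
  have "E k (\<Sum>i\<le>d. s (\<Prod>j\<in>{i<..d}. \<theta> 0 - \<theta> j) (\<tau> i v)) =
      s (\<Sum>i\<le>d. (\<Prod>j\<in>{i<..d}. \<theta> 0 - \<theta> j) * (\<Prod>j<i. \<theta> k - \<theta> j)) (E k v)"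
    using k by (simp add: L.proj_of_sum proj_\<tau> scale_sum_left)
  also have "\<dots> = s (\<Prod>j=1..d. \<theta> k - \<theta> j) (E k v)"
    by (simp add: newton_expansion)
  also have "\<dots> = E k (s (first_differences d \<theta>) (E 0 v))"
  proof (cases "k = 0")
    case True
    then show ?thesis by (simp add: first_differences_def L.proj_proj)
  next
    case False
    then have "(\<Prod>j=1..d. \<theta> k - \<theta> j) = 0" using k by (intro prod_zero) auto
    then show ?thesis using False k by (simp add: L.proj_proj)
  qed
  finally show "E k (s (first_differences d \<theta>) (E 0 v)) =
      E k (\<Sum>i\<le>d. s (\<Prod>j\<in>{i<..d}. \<theta> 0 - \<theta> j) (\<tau> i v))" by simp
qed

text \<open>In the expansion of \<open>E 0\<close>, \<open>\<tau> i\<close> with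
  \<open>i < d\<close> cannot carry \<open>E' 0 V\<close> as far as \<open>E' d V\<close>, and
  \<open>\<tau> d\<close> is a multiple of \<open>E d\<close>.\<close>

lemma corner:
  assumes "v \<in> range (E' 0)"
  shows "s (first_differences d \<theta>) (E' d (E 0 v)) = s (last_differences d \<theta>) (E' d (E d v))"
proof -
  have "s (first_differences d \<theta>) (E' d (E 0 v)) =
      (\<Sum>i\<le>d. s (\<Prod>j\<in>{i<..d}. \<theta> 0 - \<theta> j) (E' d (\<tau> i v)))"
    using first_differences_E0[of v]
    by (simp add: R.proj_of_sum flip: R.proj_scale)
  also have "\<dots> = (\<Sum>i\<in>{d}. s (\<Prod>j\<in>{i<..d}. \<theta> 0 - \<theta> j) (E' d (\<tau> i v)))"
    using low_\<tau>[OF assms] by (intro sum.mono_neutral_right) auto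
  also have "\<dots> = s (last_differences d \<theta>) (E' d (E d v))"
    by (simp add: \<tau>_d)
  finally show ?thesis .
qed

lemma corner_rank_one:
  assumes p: "rank_one s (E 0) \<phi>\<^sub>0 e\<^sub>0" and d: "rank_one s (E d) \<phi>\<^sub>d e\<^sub>d"
    and q: "rank_one s (E' 0) \<alpha> a" and d': "rank_one s (E' d) \<beta> b"
  shows "first_differences d \<theta> * (\<phi>\<^sub>0 a * \<beta> e\<^sub>0) = last_differences d \<theta> * (\<phi>\<^sub>d a * \<beta> e\<^sub>d)"
proof -
  have \<beta>: "\<beta> (s c v) = c * \<beta> v" for c v
    by (rule rank_one_scale[OF d' R.linear_proj]) simp
  have "s (first_differences d \<theta> * \<beta> (E 0 a)) b = s (last_differences d \<theta> * \<beta> (E d a)) b"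
    using corner[of a] q d' unfolding rank_one_def by (metis scale_scale)
  then have "first_differences d \<theta> * \<beta> (E 0 a) = last_differences d \<theta> * \<beta> (E d a)"
    using d' by (simp add: rank_one_def)
  moreover have "E 0 a = s (\<phi>\<^sub>0 a) e\<^sub>0" "E d a = s (\<phi>\<^sub>d a) e\<^sub>d"
    using p d by (simp_all add: rank_one_def)
  ultimately show ?thesis by (simp add: \<beta>)
qed

text \<open>The two sides turn out to be the last split terms of \<open>\<Phi>\<close> and
  \<open>\<Phi>\<^sup>*\<close>. The corner relations for \<open>\<Phi>\<^sup>\<down>\<close> and
  \<open>\<Phi>\<^sup>*\<close> share the quantity \<open>\<phi>\<^sub>d b\<close>; eliminating it
  leaves the claim multiplied by \<open>\<alpha> e\<^sub>0\<close>.\<close>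

lemma corner_product:
  assumes p: "rank_one s (E 0) \<phi>\<^sub>0 e\<^sub>0" and d: "rank_one s (E d) \<phi>\<^sub>d e\<^sub>d"
    and q: "rank_one s (E' 0) \<alpha> a" and d': "rank_one s (E' d) \<beta> b"
  shows "first_differences d \<theta>' * last_differences d \<theta> * (\<phi>\<^sub>d a * \<alpha> e\<^sub>d) =
    first_differences d \<theta> * last_differences d \<theta>' * (\<phi>\<^sub>0 b * \<beta> e\<^sub>0)"
proof -
  have 1: "first_differences d \<theta> * (\<phi>\<^sub>0 b * \<alpha> e\<^sub>0) = last_differences d \<theta> * (\<phi>\<^sub>d b * \<alpha> e\<^sub>d)"
    by (rule tridiagonal_sys.corner_rank_one[OF reverse' p d]) (use q d' in simp_all)
  have 2: "first_differences d \<theta>' * (\<alpha> e\<^sub>0 * \<phi>\<^sub>d a) = last_differences d \<theta>' * (\<beta> e\<^sub>0 * \<phi>\<^sub>d b)"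
    by (rule tridiagonal_sys.corner_rank_one[OF dual q d' p d])
  \<comment> \<open>The factor to be cancelled is nonzero by irreducibility, used for the dual
    system.\<close>
  have "E' 0 e\<^sub>0 \<noteq> 0"
    using tridiagonal_sys.E0_range_injective[OF dual, of e\<^sub>0] p by (auto simp: rank_one_def)
  then have "\<alpha> e\<^sub>0 \<noteq> 0" using q by (auto simp: rank_one_def)
  moreover have "first_differences d \<theta>' * last_differences d \<theta> * (\<phi>\<^sub>d a * \<alpha> e\<^sub>d) * \<alpha> e\<^sub>0 =
      first_differences d \<theta> * last_differences d \<theta>' * (\<phi>\<^sub>0 b * \<beta> e\<^sub>0) * \<alpha> e\<^sub>0"
    using 1 2 by algebra
  ultimately show ?thesis by simp
qed

section \<open>Split sequences in terms of rank-one factors\<close>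

lemma split_space_0: "split_space d E E' 0 = range (E' 0)"
proof -
  have "v \<in> (\<Sum>j\<in>{0..d}. range (E j))" for v
    unfolding set_sum_alt[OF finite_atLeastAtMost]
    using L.proj_sum[of v] by (auto simp: atLeast0AtMost intro!: exI[of _ "\<lambda>j. E j v"])
  then show ?thesis by (auto simp: split_space_def)
qed

text \<open>Of the components \<open>E' k\<close> of \<open>\<tau> i v\<close>, those with
  \<open>k > i\<close> are zero already and those with \<open>1 \<le> k \<le> i\<close> are killed
  by the factor \<open>A' - \<theta>' k\<close>. Only \<open>k = 0\<close> survives.\<close>

lemma split_operator_eq:
  assumes i: "i \<le> d" and v: "v \<in> range (E' 0)"
  shows "split_operator s A E A' E' i v = s (\<Prod>j=1..i. \<theta>' 0 - \<theta>' j) (E' 0 (\<tau> i v))"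
proof (rule R.proj_eqI)
  fix k assume k: "k \<le> d"
  have "map (\<lambda>j. shifted s A (eigenvalue_seq s A E j)) (rev [0..<i]) =
      map (\<lambda>j. shifted s A (\<theta> j)) (rev [0..<i])"
    "map (\<lambda>j. shifted s A' (eigenvalue_seq s A' E' j)) [1..<Suc i] =
      map (\<lambda>j. shifted s A' (\<theta>' j)) [1..<Suc i]"
    using i by (auto simp: L.eigenvalue_seq_eq R.eigenvalue_seq_eq simp del: upt_Suc)
  then have "split_operator s A E A' E' i v =
      comp_list (map (\<lambda>j. shifted s A' (\<theta>' j)) [1..<Suc i]) (\<tau> i v)"
    by (simp only: split_operator_def o_apply \<tau>_def)
  then have "E' k (split_operator s A E A' E' i v) =
      s (\<Prod>j\<leftarrow>[1..<Suc i]. \<theta>' k - \<theta>' j) (E' k (\<tau> i v))"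
    using k by (simp only: R.proj_comp_shifted)
  also have "(\<Prod>j\<leftarrow>[1..<Suc i]. \<theta>' k - \<theta>' j) = (\<Prod>j=1..i. \<theta>' k - \<theta>' j)"
    by (simp add: atLeastLessThanSuc_atLeastAtMost del: upt_Suc
        flip: prod.distinct_set_conv_list)
  also have "s (\<Prod>j=1..i. \<theta>' k - \<theta>' j) (E' k (\<tau> i v)) =
      E' k (s (\<Prod>j=1..i. \<theta>' 0 - \<theta>' j) (E' 0 (\<tau> i v)))"
  proof -
    consider "k = 0" | "0 < k" "k \<le> i" | "i < k" by linarith
    then show ?thesis
    proof cases
      case 1
      then show ?thesis by (simp add: R.proj_proj)
    next
      case 2
      then have "(\<Prod>j=1..i. \<theta>' k - \<theta>' j) = 0" by (intro prod_zero) auto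
      then show ?thesis using 2 k by (simp add: R.proj_proj)
    next
      case 3
      then show ?thesis using k low_\<tau>[OF v] by (simp add: R.proj_proj)
    qed
  qed
  finally show "E' k (split_operator s A E A' E' i v) =
    E' k (s (\<Prod>j=1..i. \<theta>' 0 - \<theta>' j) (E' 0 (\<tau> i v)))" .
qed

lemma split_seq_eq:
  assumes "i \<le> d" and a: "rank_one s (E' 0) \<alpha> a"
  shows "split_seq s d A E A' E' i = (\<Prod>j=1..i. \<theta>' 0 - \<theta>' j) * \<alpha> (\<tau> i a)"
proof -
  have op: "split_operator s A E A' E' i u = s ((\<Prod>j=1..i. \<theta>' 0 - \<theta>' j) * \<alpha> (\<tau> i a)) u"
    if "u \<in> range (E' 0)" for u
  proof -
    obtain v where v: "u = E' 0 v" using \<open>u \<in> range (E' 0)\<close> by auto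
    then have u: "u = s (\<alpha> v) a" using a by (simp add: rank_one_def)
    have "E' 0 (\<tau> i u) = s (\<alpha> v) (E' 0 (\<tau> i a))" by (simp add: u \<tau>_scale)
    also have "\<dots> = s (\<alpha> (\<tau> i a)) u" using a by (simp add: rank_one_def u mult.commute)
    finally show ?thesis using split_operator_eq[OF assms(1) that] by simp
  qed
  show ?thesis
    unfolding split_seq_def split_space_0
  proof (rule the_equality)
    fix z assume "\<forall>u\<in>range (E' 0). split_operator s A E A' E' i u = s z u"
    moreover have "a \<in> range (E' 0)" "a \<noteq> 0" using a by (auto simp: rank_one_def)
    ultimately show "z = (\<Prod>j=1..i. \<theta>' 0 - \<theta>' j) * \<alpha> (\<tau> i a)"
      using op[of a] by (metis scale_right_imp_eq)
  qed (use op in blast)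
qed

text \<open>Here \<open>\<phi> a * \<alpha> e\<close> is the trace of \<open>E d E' 0\<close>, so
  relatives that use the same two idempotents in these roles share their last term.\<close>

lemma split_seq_last:
  assumes "rank_one s (E' 0) \<alpha> a" "rank_one s (E d) \<phi> e"
  shows "split_seq s d A E A' E' d =
    first_differences d \<theta>' * last_differences d \<theta> * (\<phi> a * \<alpha> e)"
proof -
  have "\<alpha> (s c v) = c * \<alpha> v" for c v
    by (rule rank_one_scale[OF assms(1) R.linear_proj]) simp
  moreover have "E d a = s (\<phi> a) e" using assms(2) by (simp add: rank_one_def)
  ultimately show ?thesis
    using split_seq_eq[OF order_refl assms(1)] by (simp add: \<tau>_d first_differences_def)
qed

text \<open>The right-hand side is the last term of \<open>\<Phi>\<^sup>\<Down>\<close>: it comes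
  from compressing the expansion of \<open>E 0\<close> to the line \<open>E' 0 V\<close>.\<close>

lemma sum_split_seq:
  assumes q: "rank_one s (E' 0) \<alpha> a" and p: "rank_one s (E 0) \<phi> e"
  shows "(\<Sum>i\<le>d. (\<Prod>j\<in>{i<..d}. \<theta> 0 - \<theta> j) * (\<Prod>j\<in>{i<..d}. \<theta>' 0 - \<theta>' j) *
      split_seq s d A E A' E' i) = first_differences d \<theta>' * first_differences d \<theta> * (\<phi> a * \<alpha> e)"
    (is "?S = _")
proof -
  have E'0: "E' 0 v = s (\<alpha> v) a" for v using q by (simp add: rank_one_def)
  \<comment> \<open>The factor from \<open>\<eta>\<^sup>*\<close> completes the one inside
    \<open>\<zeta> i\<close> to a product independent of \<open>i\<close>.\<close>
  have prod: "(\<Prod>j\<in>{i<..d}. \<theta>' 0 - \<theta>' j) * (\<Prod>j=1..i. \<theta>' 0 - \<theta>' j) = first_differences d \<theta>'"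
    if "i \<le> d" for i
  proof -
    have "{1..d} = {i<..d} \<union> {1..i}" using that by auto
    then show ?thesis unfolding first_differences_def
      by (simp only:) (rule prod.union_disjoint[symmetric], auto)
  qed
  have "?S = (\<Sum>i\<le>d. first_differences d \<theta>' * ((\<Prod>j\<in>{i<..d}. \<theta> 0 - \<theta> j) * \<alpha> (\<tau> i a)))"
    by (rule sum.cong) (simp_all add: split_seq_eq[OF _ q] mult.assoc mult.left_commute flip: prod)
  also have "\<dots> = first_differences d \<theta>' * (\<Sum>i\<le>d. (\<Prod>j\<in>{i<..d}. \<theta> 0 - \<theta> j) * \<alpha> (\<tau> i a))"
    by (simp add: sum_distrib_left)
  also have "(\<Sum>i\<le>d. (\<Prod>j\<in>{i<..d}. \<theta> 0 - \<theta> j) * \<alpha> (\<tau> i a)) =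
      first_differences d \<theta> * (\<phi> a * \<alpha> e)" (is "?T = _")
  proof -
    \<comment> \<open>Both expressions are found as the coefficient of \<open>a\<close>, which is
      nonzero.\<close>
    have "s ?T a = E' 0 (s (first_differences d \<theta>) (E 0 a))"
      unfolding first_differences_E0 R.proj_of_sum[OF le0] R.proj_scale[OF le0]
      by (simp add: scale_sum_left E'0)
    also have "E 0 a = s (\<phi> a) e" using p by (simp add: rank_one_def)
    also have "E' 0 (s (first_differences d \<theta>) (s (\<phi> a) e)) =
        s (first_differences d \<theta> * (\<phi> a * \<alpha> e)) a"
      unfolding R.proj_scale[OF le0] by (simp add: E'0 mult.assoc)
    finally show ?thesis using q by (simp add: rank_one_def)
  qed
  finally show ?thesis by (simp add: mult.assoc)
qed

end

section \<open>The last split terms of the eight relatives\<close>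

theorem theorem8p2:
  fixes s :: "'k::field \<Rightarrow> 'v::ab_group_add \<Rightarrow> 'v"
    and B :: "'v set"
    and d :: nat
    and A A' :: "'v \<Rightarrow> 'v"
    and E E' :: "nat \<Rightarrow> 'v \<Rightarrow> 'v"
    and \<theta> \<theta>' \<zeta> :: "nat \<Rightarrow> 'k"
  assumes "finite_dimensional_vector_space s B"
    and "vector_space.dim s (UNIV :: 'v set) > 0"
    and "tridiagonal_system s d A E A' E'"
    and "sharp s E"
    and "\<And>i. i \<le> d \<Longrightarrow> \<theta> i = eigenvalue_seq s A E i"
    and "\<And>i. i \<le> d \<Longrightarrow> \<theta>' i = eigenvalue_seq s A' E' i"
    and "\<And>i. i \<le> d \<Longrightarrow> \<zeta> i = split_seq s d A E A' E' i"
  shows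
    "(split_seq s d A E A' E' d = \<zeta> d \<and>
      split_seq s d A' E' A E d = \<zeta> d \<and>
      split_seq s d A (\<lambda>i. E (d - i)) A' (\<lambda>i. E' (d - i)) d = \<zeta> d \<and>
      split_seq s d A' (\<lambda>i. E' (d - i)) A (\<lambda>i. E (d - i)) d = \<zeta> d) \<and>
     (let S = (\<Sum>i=0..d. poly (eta_poly d \<theta> (d - i)) (\<theta> 0) *
                         poly (eta_poly d \<theta>' (d - i)) (\<theta>' 0) * \<zeta> i)
      in split_seq s d A E A' (\<lambda>i. E' (d - i)) d = S \<and>
         split_seq s d A (\<lambda>i. E (d - i)) A' E' d = S \<and>
         split_seq s d A' (\<lambda>i. E' (d - i)) A E d = S \<and>
         split_seq s d A' E' A (\<lambda>i. E (d - i)) d = S)"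
proof -
  interpret finite_dimensional_vector_space s B by (rule assms(1))
  let ?\<theta> = "eigenvalue_seq s A E" and ?\<theta>' = "eigenvalue_seq s A' E'"
  have pair: "tridiagonal_pair s A A'" and
    idem: "E ` {..d} \<subseteq> primitive_idempotents s A" "E' ` {..d} \<subseteq> primitive_idempotents s A'" and
    ord: "standard_ordering s A A' d (\<lambda>i. range (E i))"
      "standard_ordering s A' A d (\<lambda>i. range (E' i))"
    using assms(3) by (auto simp: tridiagonal_system_def bij_betw_def)
  have sys: "tridiagonal_sys s d A E ?\<theta> A' E' ?\<theta>'"
  proof (intro tridiagonal_sys.intro tridiagonal_sys_axioms.intro)
    show "tridiagonal_action s d A E ?\<theta> A'" "tridiagonal_action s d A' E' ?\<theta>' A"
      using pair idem ord vector_space_axioms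
      by (auto simp: tridiagonal_pair_def intro!: tridiagonal_actionI)
    show "W = {0} \<or> W = UNIV" if "subspace W" "A ` W \<subseteq> W" "A' ` W \<subseteq> W" for W
      using pair that unfolding tridiagonal_pair_def by blast
  qed (rule vector_space_axioms)
  note rev = tridiagonal_sys.reverse[OF sys] and rev' = tridiagonal_sys.reverse'[OF sys]
  note rev_rev' = tridiagonal_sys.reverse[OF rev']
  obtain \<phi>\<^sub>0 e\<^sub>0 where p: "rank_one s (E 0) \<phi>\<^sub>0 e\<^sub>0"
    using rank_one_if_dim_eq_1[of "E 0"] assms(4) by (auto simp: sharp_def)
  obtain \<alpha> a where q: "rank_one s (E' 0) \<alpha> a"
    using tridiagonal_sys.rank_one_E'0[OF sys p] by auto
  obtain \<beta> b where d': "rank_one s (E' d) \<beta> b"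
    using tridiagonal_sys.rank_one_E'0[OF rev' p] by auto
  \<comment> \<open>In the dual of the system with \<open>E\<close> reversed, \<open>E d\<close>
    takes the place of \<open>E' 0\<close>.\<close>
  obtain \<phi>\<^sub>d e\<^sub>d where d: "rank_one s (E d) \<phi>\<^sub>d e\<^sub>d"
    using tridiagonal_sys.rank_one_E'0[OF tridiagonal_sys.dual[OF rev] q] by auto
  note last = tridiagonal_sys.split_seq_last
  \<comment> \<open>The first and fourth terms use \<open>E d\<close> and \<open>E' 0\<close>, the
    second and third \<open>E 0\<close> and \<open>E' d\<close>.\<close>
  note 1 = last[OF sys q d]
    last[OF tridiagonal_sys.dual[OF sys] p d']
    last[OF rev_rev', of \<beta> b \<phi>\<^sub>0 e\<^sub>0]
    last[OF tridiagonal_sys.dual[OF rev_rev'], of \<phi>\<^sub>d e\<^sub>d \<alpha> a]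
  \<comment> \<open>The first and fourth terms use \<open>E d\<close> and \<open>E' d\<close>, the
    second and third \<open>E 0\<close> and \<open>E' 0\<close>; the latter pair equals the
    sum.\<close>
  note 2 = last[OF rev', of \<beta> b \<phi>\<^sub>d e\<^sub>d]
    last[OF rev, of \<alpha> a \<phi>\<^sub>0 e\<^sub>0]
    last[OF tridiagonal_sys.dual[OF rev'], of \<phi>\<^sub>0 e\<^sub>0 \<alpha> a]
    last[OF tridiagonal_sys.dual[OF rev], of \<phi>\<^sub>d e\<^sub>d \<beta> b]
  \<comment> \<open>One instance joins the two pairs of (i); the other, for
    \<open>\<Phi>\<^sup>\<Down>\<close>, joins those of (ii).\<close>
  note product = tridiagonal_sys.corner_product[OF sys p d q d']
    tridiagonal_sys.corner_product[OF rev, of \<phi>\<^sub>d e\<^sub>d \<phi>\<^sub>0 e\<^sub>0 \<alpha> a \<beta> b]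
  have sum: "(\<Sum>i=0..d. poly (eta_poly d \<theta> (d - i)) (\<theta> 0) *
      poly (eta_poly d \<theta>' (d - i)) (\<theta>' 0) * \<zeta> i) =
      first_differences d ?\<theta>' * first_differences d ?\<theta> * (\<phi>\<^sub>0 a * \<alpha> e\<^sub>0)"
    unfolding tridiagonal_sys.sum_split_seq[OF sys q p, symmetric] atLeast0AtMost
    using assms(5-7) by (intro sum.cong refl) (simp add: poly_eta_poly)
  show ?thesis
    unfolding Let_def sum assms(7)[OF order_refl]
    using 1 2 product p d q d' by (simp add: mult.commute)
qed

end
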